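(* Let $\operatorname{Im}z>0$ and, for $n,m\ge1$, let $$G_{nm}(z)=\langle\!\langle p_{n-1}^R,(x-z)^{-1}p_{m-1}^R\rangle\!\rangle_R .$$ Then $$G_{nm}(z)=\begin{cases}\psi_{n-1}^L(z)\,p_{m-1}^R(z),& n\ge m,\\ p_{n-1}^L(z)\,\psi_{m-1}^R(z),& n\le m.\end{cases}$$
   Context: Fix $l\ge1$; $^\dagger$ is the Hermitian adjoint and $\mathbf 1$ the $l\times l$ identity. $d\mu$ is a positive semi-definite $l\times l$ matrix-valued measure on $\mathbb R$ with compact support and $\mu(\mathbb R)=\mathbf 1$. For matrix-valued functions $f,g$ on $\mathbb R$, $\langle\!\langle f,g\rangle\!\rangle_R=\int f(x)^\dagger\,d\mu(x)\,g(x)$. The measure is assumed non-trivial: $\operatorname{Tr}\langle\!\langle f,f\rangle\!\rangle_R>0$ for every non-zero polynomial $f$ with $l\times l$ matrix coefficients. $(p_n^R)_{n\ge0}$ is a sequence of right orthonormal matrix polynomials: $\deg p_n^R= n$, $p_0^R=\mathbf 1$, $\langle\!\langle p_n^R,p_m^R\rangle\!\rangle_R=\delta_{nm}\mathbf 1$ (explicitly $p_n^R=P_n^R\langle\!\langle P_n^R,P_n^R\rangle\!\rangle_R^{-1/2}\sigma_n$ with $P_n^R$ the monic polynomial of degree $n$ right-orthogonal to all polynomials of lower degree, $\sigma_n$ unitary, $\sigma_0=\mathbf 1$). The left polynomials are $p_n^L(z)=p_n^R(\bar z)^\dagger$. The $m$-function is $m(z)=\int\frac{d\mu(x)}{x-z}$.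 The second kind polynomials are, for $n\ge0$, $$q_n^R(z)=\int d\mu(x)\,\frac{p_n^R(z)-p_n^R(x)}{z-x},\qquad q_n^L(z)=\int\frac{p_n^L(z)-p_n^L(x)}{z-x}\,d\mu(x),$$ and $\psi_n^R(z)=q_n^R(z)+m(z)p_n^R(z)$, $\psi_n^L(z)=q_n^L(z)+p_n^L(z)m(z)$. *)

theory Defs
  imports "HOL-Analysis.Analysis" "HOL-Computational_Algebra.Polynomial"
begin

definition hadjoint :: "complex^'l^'l \<Rightarrow> complex^'l^'l" where
  "hadjoint A = (\<chi> i j. cnj (A $ j $ i))"

definition cscale :: "complex \<Rightarrow> complex^'l^'l \<Rightarrow> complex^'l^'l" where
  "cscale c A = (\<chi> i j. c * A $ i $ j)"

definition quad_form :: "complex^'l^'l \<Rightarrow> complex^'l \<Rightarrow> complex" where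
  "quad_form A v = (\<Sum>i\<in>UNIV. \<Sum>j\<in>UNIV. cnj (v $ i) * A $ i $ j * v $ j)"

definition pos_semidef :: "complex^'l^'l \<Rightarrow> bool" where
  "pos_semidef A \<longleftrightarrow> hadjoint A = A \<and> (\<forall>v. 0 \<le> Re (quad_form A v))"


text \<open>
  A matrix-valued measure is a set function; only its values on Borel sets are constrained, and
  only these are ever used.
\<close>

definition matrix_measure :: "(real set \<Rightarrow> complex^'l^'l) \<Rightarrow> bool" where
  "matrix_measure \<mu> \<longleftrightarrow>
     (\<forall>A\<in>sets borel. pos_semidef (\<mu> A)) \<and>
     (\<forall>A. range A \<subseteq> sets borel \<longrightarrow> disjoint_family A \<longrightarrow> (\<lambda>i::nat. \<mu> (A i)) sums \<mu> (\<Union>i. A i))"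

definition compactly_supported :: "(real set \<Rightarrow> complex^'l^'l) \<Rightarrow> bool" where
  "compactly_supported \<mu> \<longleftrightarrow> (\<exists>K. compact K \<and> \<mu> (- K) = 0)"

text \<open>
  Each vector \<open>v\<close> gives a finite positive scalar measure, \<open>A \<mapsto> v\<^sup>\<dagger> \<mu>(A) v\<close>. The entry
  \<open>\<mu>\<^sub>j\<^sub>k\<close> is a complex measure, and by polarization
  \<open>\<mu>\<^sub>j\<^sub>k(A) = 1/4 * (\<Sum>c\<in>{1,\<i>,-1,-\<i>}. cnj c * w\<^sub>c\<^sup>\<dagger> \<mu>(A) w\<^sub>c)\<close> with \<open>w\<^sub>c = e\<^sub>j + c e\<^sub>k\<close>.
  The integral of a scalar function against \<open>d\<mu>\<^sub>j\<^sub>k\<close> is the corresponding combination of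
  Lebesgue integrals.
\<close>

definition vec_measure :: "(real set \<Rightarrow> complex^'l^'l) \<Rightarrow> complex^'l \<Rightarrow> real measure" where
  "vec_measure \<mu> v = measure_of UNIV (sets borel) (\<lambda>A. ennreal (Re (quad_form (\<mu> A) v)))"

definition entry_integral ::
    "(real set \<Rightarrow> complex^'l^'l) \<Rightarrow> 'l \<Rightarrow> 'l \<Rightarrow> (real \<Rightarrow> complex) \<Rightarrow> complex" where
  "entry_integral \<mu> j k f =
     (\<Sum>c\<in>{1, \<i>, -1, -\<i>}. cnj c * (LINT x | vec_measure \<mu> (axis j 1 + axis k c). f x)) / 4"

text \<open>The matrix \<open>\<integral> F(x) d\<mu>(x) G(x)\<close>.\<close>

definition matrix_integral ::
    "(real set \<Rightarrow> complex^'l^'l) \<Rightarrow> (real \<Rightarrow> complex^'l^'l) \<Rightarrow> (real \<Rightarrow> complex^'l^'l) \<Rightarrow> complex^'l^'l"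
  where
  "matrix_integral \<mu> F G =
     (\<chi> a b. \<Sum>j\<in>UNIV. \<Sum>k\<in>UNIV. entry_integral \<mu> j k (\<lambda>x. F x $ a $ j * G x $ k $ b))"

lemma space_vec_measure [simp]: "space (vec_measure \<mu> v) = UNIV"
  and sets_vec_measure [simp]: "sets (vec_measure \<mu> v) = sets borel"
  by (simp_all add: vec_measure_def sets.sigma_sets_eq[of borel, simplified])

lemma emeasure_vec_measure:
  assumes "matrix_measure \<mu>" and "A \<in> sets borel"
  shows "emeasure (vec_measure \<mu> v) A = ennreal (Re (quad_form (\<mu> A) v))"
proof -
  let ?q = "\<lambda>A. Re (quad_form (\<mu> A) v)"
  have nonneg: "0 \<le> ?q B" if "B \<in> sets borel" for B
    using assms(1) that by (auto simp: matrix_measure_def pos_semidef_def)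
  have sums: "(\<lambda>i. ?q (B i)) sums ?q (\<Union>i. B i)"
    if "range B \<subseteq> sets borel" "disjoint_family B" for B :: "nat \<Rightarrow> real set"
  proof -
    have "(\<lambda>i. \<mu> (B i)) sums \<mu> (\<Union>i. B i)"
      using assms(1) that by (auto simp: matrix_measure_def)
    then have "(\<lambda>i. \<mu> (B i) $ a $ b) sums (\<mu> (\<Union>i. B i) $ a $ b)" for a b
      by (intro bounded_linear.sums[OF bounded_linear_vec_nth])
    then show ?thesis
      unfolding quad_form_def
      by (intro sums_Re sums_sum sums_mult sums_mult2)
  qed
  have "(\<lambda>i::nat. \<mu> {}) sums \<mu> {}"
    using assms(1) unfolding matrix_measure_def
    by (auto dest!: spec[of _ "\<lambda>i::nat. {}"] simp: disjoint_family_on_def)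
  from summable_LIMSEQ_zero[OF sums_summable[OF this]] have "\<mu> {} = 0"
    by (simp add: LIMSEQ_const_iff)
  then have empty: "?q {} = 0"
    by (simp add: quad_form_def)
  show ?thesis
    unfolding vec_measure_def
  proof (rule emeasure_measure_of_sigma)
    show "sigma_algebra UNIV (sets (borel :: real measure))"
      using sets.sigma_algebra_axioms[of "borel :: real measure"] by simp
    show "positive (sets borel) (\<lambda>A. ennreal (?q A))"
      by (simp add: positive_def empty)
    show "countably_additive (sets borel) (\<lambda>A. ennreal (?q A))"
    proof (rule countably_additiveI)
      fix B :: "nat \<Rightarrow> real set"
      assume B: "range B \<subseteq> sets borel" "disjoint_family B"
      show "(\<Sum>i. ennreal (?q (B i))) = ennreal (?q (\<Union>i. B i))"
        using sums[OF B] nonneg B(1) by (intro suminf_ennreal_eq) auto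
    qed
    show "A \<in> sets borel" by fact
  qed
qed

lemma quad_form_axis:
  "quad_form A (axis j 1 + axis k c) =
     A $ j $ j + c * A $ j $ k + cnj c * A $ k $ j + cnj c * c * A $ k $ k"
proof -
  have row: "(\<Sum>b\<in>UNIV. A $ a $ b * (axis j 1 + axis k c) $ b) = A $ a $ j + c * A $ a $ k" for a
    by (simp add: axis_def algebra_simps sum.distrib if_distrib[of "\<lambda>x. _ * x"] cong: if_cong)
  have "quad_form A (axis j 1 + axis k c) =
      (\<Sum>a\<in>UNIV. cnj ((axis j 1 + axis k c) $ a) * (A $ a $ j + c * A $ a $ k))"
    unfolding quad_form_def row[symmetric] by (simp add: sum_distrib_left mult.assoc)
  also have "\<dots> = (A $ j $ j + c * A $ j $ k) + cnj c * (A $ k $ j + c * A $ k $ k)"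
    by (simp add: axis_def distrib_right sum.distrib if_distrib[of cnj] if_distrib[of "\<lambda>x. x * _"]
        cong: if_cong)
  finally show ?thesis
    by (simp add: algebra_simps)
qed

lemma quad_form_real:
  assumes "hadjoint A = A"
  shows "of_real (Re (quad_form A v)) = quad_form A v"
proof -
  have A: "cnj (A $ i $ j) = A $ j $ i" for i j
    using arg_cong[OF assms, of "\<lambda>M. M $ j $ i"] by (simp add: hadjoint_def)
  have "cnj (quad_form A v) = (\<Sum>i\<in>UNIV. \<Sum>j\<in>UNIV. cnj (v $ j) * A $ j $ i * v $ i)"
    by (simp add: quad_form_def A mult_ac)
  also have "\<dots> = quad_form A v"
    unfolding quad_form_def by (rule sum.swap)
  finally show ?thesis
    by (simp add: complex_eq_iff)
qed

text \<open>
  On indicators the integrals return the matrix measure itself.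
\<close>

lemma entry_integral_indicator:
  assumes "matrix_measure \<mu>" and "A \<in> sets borel"
  shows "entry_integral \<mu> j k (indicator A) = \<mu> A $ j $ k"
proof -
  have psd: "pos_semidef (\<mu> A)"
    using assms by (auto simp: matrix_measure_def)
  have int: "(LINT x | vec_measure \<mu> v. indicator A x) = quad_form (\<mu> A) v" for v
  proof -
    have "(LINT x | vec_measure \<mu> v. indicator A x :: complex) =
        (LINT x | vec_measure \<mu> v. complex_of_real (indicator A x))"
      by (intro Bochner_Integration.integral_cong) (auto simp: indicator_def)
    also have "\<dots> = of_real (measure (vec_measure \<mu> v) A)"
      by simp
    also have "\<dots> = of_real (Re (quad_form (\<mu> A) v))"
      using psd by (simp add: measure_def emeasure_vec_measure[OF assms] pos_semidef_def)
    finally show ?thesis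
      using psd by (simp add: quad_form_real pos_semidef_def)
  qed
  have "1 \<noteq> \<i>" "1 \<noteq> - \<i>" "\<i> \<noteq> -1" "\<i> \<noteq> - \<i>" "(-1::complex) \<noteq> - \<i>" "(1::complex) \<noteq> -1"
    by (auto simp: complex_eq_iff)
  then show ?thesis
    unfolding entry_integral_def int quad_form_axis
    by (simp add: algebra_simps)
qed

lemma matrix_integral_indicator:
  assumes "matrix_measure \<mu>" and "A \<in> sets borel"
  shows "matrix_integral \<mu> (\<lambda>x. mat 1) (\<lambda>x. cscale (indicator A x) (mat 1)) = \<mu> A"
proof -
  have zero: "entry_integral \<mu> j k (\<lambda>x. 0) = 0" for j k
    by (simp add: entry_integral_def)
  have "(\<Sum>j\<in>UNIV. \<Sum>k\<in>UNIV. entry_integral \<mu> j k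
           (\<lambda>x. mat 1 $ a $ j * cscale (indicator A x) (mat 1) $ k $ b)) =
        (\<Sum>j\<in>UNIV. \<Sum>k\<in>UNIV. if k = b then if j = a then \<mu> A $ j $ k else 0 else 0)" for a b
    using entry_integral_indicator[OF assms]
    by (intro sum.cong refl) (auto simp: mat_def cscale_def zero)
  then show ?thesis
    by (simp add: matrix_integral_def vec_eq_iff)
qed


definition inner_R ::
    "(real set \<Rightarrow> complex^'l^'l) \<Rightarrow> (real \<Rightarrow> complex^'l^'l) \<Rightarrow> (real \<Rightarrow> complex^'l^'l) \<Rightarrow> complex^'l^'l"
  where
  "inner_R \<mu> f g = matrix_integral \<mu> (\<lambda>x. hadjoint (f x)) g"

text \<open>
  The type \<open>(complex^'l^'l) poly\<close> is used for its coefficients, its degree and \<open>0\<close> only; its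
  elements are evaluated at complex numbers. Since the variable is a scalar, it does not matter on
  which side of it the coefficients stand.
\<close>

definition mpoly_eval :: "(complex^'l^'l) poly \<Rightarrow> complex \<Rightarrow> complex^'l^'l" where
  "mpoly_eval P z = (\<Sum>k\<le>degree P. cscale (z ^ k) (coeff P k))"

definition nontrivial :: "(real set \<Rightarrow> complex^'l^'l) \<Rightarrow> bool" where
  "nontrivial \<mu> \<longleftrightarrow>
     (\<forall>P. P \<noteq> 0 \<longrightarrow>
        0 < Re (trace (inner_R \<mu> (\<lambda>x. mpoly_eval P (of_real x)) (\<lambda>x. mpoly_eval P (of_real x)))))"

definition right_orthonormal ::
    "(real set \<Rightarrow> complex^'l^'l) \<Rightarrow> (nat \<Rightarrow> (complex^'l^'l) poly) \<Rightarrow> bool" where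
  "right_orthonormal \<mu> p \<longleftrightarrow>
     (\<forall>n. degree (p n) = n) \<and> p 0 = [:mat 1:] \<and>
     (\<forall>n m. inner_R \<mu> (\<lambda>x. mpoly_eval (p n) (of_real x)) (\<lambda>x. mpoly_eval (p m) (of_real x)) =
        (if n = m then mat 1 else 0))"

definition p_R :: "(nat \<Rightarrow> (complex^'l^'l) poly) \<Rightarrow> nat \<Rightarrow> complex \<Rightarrow> complex^'l^'l" where
  "p_R p n z = mpoly_eval (p n) z"

definition p_L :: "(nat \<Rightarrow> (complex^'l^'l) poly) \<Rightarrow> nat \<Rightarrow> complex \<Rightarrow> complex^'l^'l" where
  "p_L p n z = hadjoint (p_R p n (cnj z))"

definition m_fun :: "(real set \<Rightarrow> complex^'l^'l) \<Rightarrow> complex \<Rightarrow> complex^'l^'l" where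
  "m_fun \<mu> z = matrix_integral \<mu> (\<lambda>x. mat 1) (\<lambda>x. cscale (1 / (of_real x - z)) (mat 1))"

text \<open>
  The difference quotients below are meant for non-real \<open>z\<close>, where no denominator vanishes; for
  real \<open>z\<close> the point \<open>x = z\<close> would contribute the value 0 instead of the derivative.
\<close>

definition q_R ::
    "(real set \<Rightarrow> complex^'l^'l) \<Rightarrow> (nat \<Rightarrow> (complex^'l^'l) poly) \<Rightarrow> nat \<Rightarrow> complex \<Rightarrow> complex^'l^'l"
  where
  "q_R \<mu> p n z = matrix_integral \<mu> (\<lambda>x. mat 1)
     (\<lambda>x. cscale (1 / (z - of_real x)) (p_R p n z - p_R p n (of_real x)))"

definition q_L ::
    "(real set \<Rightarrow> complex^'l^'l) \<Rightarrow> (nat \<Rightarrow> (complex^'l^'l) poly) \<Rightarrow> nat \<Rightarrow> complex \<Rightarrow> complex^'l^'l"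
  where
  "q_L \<mu> p n z = matrix_integral \<mu>
     (\<lambda>x. cscale (1 / (z - of_real x)) (p_L p n z - p_L p n (of_real x))) (\<lambda>x. mat 1)"

definition psi_R ::
    "(real set \<Rightarrow> complex^'l^'l) \<Rightarrow> (nat \<Rightarrow> (complex^'l^'l) poly) \<Rightarrow> nat \<Rightarrow> complex \<Rightarrow> complex^'l^'l"
  where
  "psi_R \<mu> p n z = q_R \<mu> p n z + m_fun \<mu> z ** p_R p n z"

definition psi_L ::
    "(real set \<Rightarrow> complex^'l^'l) \<Rightarrow> (nat \<Rightarrow> (complex^'l^'l) poly) \<Rightarrow> nat \<Rightarrow> complex \<Rightarrow> complex^'l^'l"
  where
  "psi_L \<mu> p n z = q_L \<mu> p n z + p_L p n z ** m_fun \<mu> z"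

text \<open>Meaningful for \<open>n, m \<ge> 1\<close> only.\<close>

definition green ::
    "(real set \<Rightarrow> complex^'l^'l) \<Rightarrow> (nat \<Rightarrow> (complex^'l^'l) poly) \<Rightarrow> nat \<Rightarrow> nat \<Rightarrow> complex \<Rightarrow> complex^'l^'l"
  where
  "green \<mu> p n m z = inner_R \<mu> (\<lambda>x. p_R p (n - 1) (of_real x))
     (\<lambda>x. cscale (1 / (of_real x - z)) (p_R p (m - 1) (of_real x)))"

end

theory Submission
  imports Defs
begin

text \<open>
  Since \<open>q\<close> integrates a difference quotient and \<open>m(z) p(z)\<close> restores the term that the quotient
  subtracts, the functions \<open>\<psi>\<close> are Cauchy transforms:
  \<open>\<psi>\<^sub>n\<^sup>R(z) = \<integral> d\<mu>(x) p\<^sub>n\<^sup>R(x) / (x - z)\<close> and \<open>\<psi>\<^sub>n\<^sup>L(z) = \<integral> p\<^sub>n\<^sup>L(x) / (x - z) d\<mu>(x)\<close>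
  (\<open>psi_R_eq_integral\<close>, \<open>psi_L_eq_integral\<close>). On the real line \<open>p\<^sub>n\<^sup>L(x)\<close> is the adjoint of
  \<open>p\<^sub>n\<^sup>R(x)\<close>, so, with indices shifted to start at 0, the Green function is
  \<open>G\<^sub>n\<^sub>m(z) = \<integral> p\<^sub>n\<^sup>L(x) d\<mu>(x) p\<^sub>m\<^sup>R(x) / (x - z)\<close>. For \<open>n \<le> m\<close> therefore

    \<open>G\<^sub>n\<^sub>m(z) - p\<^sub>n\<^sup>L(z) \<psi>\<^sub>m\<^sup>R(z) = \<integral> ((p\<^sub>n\<^sup>L(x) - p\<^sub>n\<^sup>L(z)) / (x - z)) d\<mu>(x) p\<^sub>m\<^sup>R(x)\<close>.

  The quotient is a matrix polynomial in \<open>x\<close> of degree below \<open>n\<close>, hence below \<open>m\<close>, and such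
  polynomials are orthogonal to \<open>p\<^sub>m\<^sup>R\<close>. For \<open>n \<ge> m\<close> the same argument applies with
  the difference quotient taken on the right-hand factor.

  The orthogonality (\<open>orthogonal_to_lower_degree\<close>) needs the \<open>p\<^sub>k\<^sup>R\<close> with \<open>k < n\<close> to span the
  polynomials of degree below \<open>n\<close> as a right module, which holds once their leading coefficients
  are invertible. The condition on the degrees does not give this. Invertibility
  comes from orthonormality (\<open>invertible_lead_coeff\<close>): if the leading coefficient of \<open>p\<^sub>n\<^sup>R\<close>
  annihilates \<open>V\<close>, then \<open>p\<^sub>n\<^sup>R V\<close> has degree below \<open>n\<close>, so by induction
  \<open>V = \<langle>\<langle>p\<^sub>n\<^sup>R, p\<^sub>n\<^sup>R V\<rangle>\<rangle> = 0\<close>.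
\<close>

section \<open>Matrix algebra\<close>

lemma cscale_nth [simp]: "cscale c A $ i $ j = c * A $ i $ j"
  by (simp add: cscale_def)

lemma hadjoint_nth [simp]: "hadjoint A $ i $ j = cnj (A $ j $ i)"
  by (simp add: hadjoint_def)

lemma matrix_mult_nth: "(A ** B) $ i $ j = (\<Sum>k\<in>UNIV. A $ i $ k * B $ k $ j)"
  by (simp add: matrix_matrix_mult_def)

lemma hadjoint_matrix_mult: "hadjoint (A ** B) = hadjoint B ** hadjoint A"
  by (simp add: vec_eq_iff matrix_mult_nth mult.commute)

lemma hadjoint_sum: "hadjoint (\<Sum>k\<in>S. f k) = (\<Sum>k\<in>S. hadjoint (f k))"
  by (simp add: vec_eq_iff)

lemma cscale_diff: "cscale c (A - B) = cscale c A - cscale c B"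
  by (simp add: vec_eq_iff right_diff_distrib)

lemma cscale_matrix_mult_left: "cscale c A ** B = cscale c (A ** B)"
  by (simp add: vec_eq_iff matrix_mult_nth sum_distrib_left mult.assoc)

text \<open>
  Moves the summation of a matrix product outside the double sum that defines \<open>matrix_integral\<close>.
\<close>

lemma sum_rotate:
  "(\<Sum>j\<in>A. \<Sum>k\<in>B. \<Sum>c\<in>C. t c j k) = (\<Sum>c\<in>C. \<Sum>j\<in>A. \<Sum>k\<in>B. t c j k)"
  for t :: "'a \<Rightarrow> 'b \<Rightarrow> 'c \<Rightarrow> 'd::comm_monoid_add"
proof -
  have "(\<Sum>k\<in>B. \<Sum>c\<in>C. t c j k) = (\<Sum>c\<in>C. \<Sum>k\<in>B. t c j k)" for j
    by (rule sum.swap)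
  then show ?thesis
    by (simp only:) (rule sum.swap)
qed

lemma invertible_if_right_cancel_zero:
  fixes A :: "complex^('l::finite)^'l"
  assumes "\<And>V :: complex^'l^'l. A ** V = 0 \<Longrightarrow> V = 0"
  shows "invertible A"
proof -
  have "v = 0" if "A *v v = 0" for v
  proof -
    \<comment> \<open>A kernel vector becomes a matrix by repeating it in every column.\<close>
    have "A ** (\<chi> i j. v $ i) = 0"
      using that by (simp add: vec_eq_iff matrix_mult_nth matrix_vector_mult_def)
    then have "(\<chi> i j. v $ i) = (0 :: complex^'l^'l)"
      by (rule assms)
    then show ?thesis
      by (simp add: vec_eq_iff)
  qed
  then have "\<exists>B. B ** A = mat 1"
    by (simp add: matrix_left_invertible_ker)
  then show ?thesis
    by (simp add: invertible_left_inverse)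
qed

lemma continuous_on_matrix:
  fixes F :: "'a::topological_space \<Rightarrow> complex^'l^'l"
  assumes "\<And>i j. continuous_on S (\<lambda>x. F x $ i $ j)"
  shows "continuous_on S F"
proof -
  have "continuous_on S (\<lambda>x. \<chi> i. \<chi> j. F x $ i $ j)"
    by (intro continuous_on_vec_lambda assms)
  then show ?thesis
    by simp
qed

lemma continuous_on_hadjoint [continuous_intros]:
  fixes F :: "'a::topological_space \<Rightarrow> complex^'l^'l"
  assumes "continuous_on S F"
  shows "continuous_on S (\<lambda>x. hadjoint (F x))"
  by (rule continuous_on_matrix) (simp, intro continuous_intros assms)

lemma continuous_on_cscale [continuous_intros]:
  fixes F :: "'a::topological_space \<Rightarrow> complex^'l^'l"
  assumes "continuous_on S c" "continuous_on S F"
  shows "continuous_on S (\<lambda>x. cscale (c x) (F x))"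
  by (rule continuous_on_matrix) (simp, intro continuous_intros assms)

lemma continuous_on_matrix_mult [continuous_intros]:
  fixes F G :: "'a::topological_space \<Rightarrow> complex^('l::finite)^'l"
  assumes "continuous_on S F" "continuous_on S G"
  shows "continuous_on S (\<lambda>x. F x ** G x)"
  by (rule continuous_on_matrix) (unfold matrix_mult_nth, intro continuous_intros assms)


section \<open>Integrals of continuous functions against a compactly supported matrix measure\<close>

lemma entry_integral_cmult: "entry_integral \<mu> j k (\<lambda>x. c * f x) = c * entry_integral \<mu> j k f"
  by (simp add: entry_integral_def sum_distrib_left mult_ac)

lemma entry_integral_cmult_right: "entry_integral \<mu> j k (\<lambda>x. f x * c) = entry_integral \<mu> j k f * c"
  using entry_integral_cmult[of \<mu> j k c f] by (simp add: mult.commute)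

text \<open>
  A scalar factor may be attached to either side of the measure. This lets the resolvent kernel
  \<open>1 / (x - z)\<close> move to the factor in which a difference quotient is wanted.
\<close>

lemma matrix_integral_cscale:
  "matrix_integral \<mu> F (\<lambda>x. cscale (c x) (G x)) = matrix_integral \<mu> (\<lambda>x. cscale (c x) (F x)) G"
  by (simp add: matrix_integral_def mult_ac)

context
  fixes \<mu> :: "real set \<Rightarrow> complex^('l::finite)^'l"
  assumes \<mu>: "matrix_measure \<mu>" and supp: "compactly_supported \<mu>"
begin

text \<open>
  Continuous functions form a convenient class of integrands: they are bounded on the compact
  support, and the class is closed under the operations used below. It contains the polynomials and
  \<open>x \<mapsto> 1 / (x - z)\<close> for non-real \<open>z\<close>.
\<close>

lemma integrable_vec_measure:
  fixes f :: "real \<Rightarrow> complex"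
  assumes f: "continuous_on UNIV f"
  shows "integrable (vec_measure \<mu> v) f"
proof -
  obtain K where K: "compact K" "\<mu> (- K) = 0"
    using supp by (auto simp: compactly_supported_def)
  have Kb: "K \<in> sets borel"
    using K(1) by (simp add: borel_closed compact_imp_closed)
  interpret finite_measure "vec_measure \<mu> v"
    by (rule finite_measureI) (simp add: emeasure_vec_measure[OF \<mu>])
  have "bounded (f ` K)"
    using K(1) f by (meson compact_continuous_image compact_imp_bounded continuous_on_subset subset_UNIV)
  then obtain B where B: "\<And>x. x \<in> K \<Longrightarrow> norm (f x) \<le> B"
    by (auto simp: bounded_iff)
  have "- K \<in> null_sets (vec_measure \<mu> v)"
    using Kb by (simp add: null_sets_def emeasure_vec_measure[OF \<mu>] K(2) quad_form_def)
  then have "AE x in vec_measure \<mu> v. norm (f x) \<le> B"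
    by (rule AE_I') (use B in auto)
  moreover have "f \<in> borel_measurable (vec_measure \<mu> v)"
    using borel_measurable_continuous_onI[OF f] by (simp add: measurable_def)
  ultimately show ?thesis
    by (rule integrable_const_bound)
qed

lemma entry_integral_sum:
  assumes "\<And>i. i \<in> S \<Longrightarrow> continuous_on UNIV (f i)"
  shows "entry_integral \<mu> j k (\<lambda>x. \<Sum>i\<in>S. f i x) = (\<Sum>i\<in>S. entry_integral \<mu> j k (f i))"
proof -
  have "(LINT x | vec_measure \<mu> v. (\<Sum>i\<in>S. f i x)) = (\<Sum>i\<in>S. (LINT x | vec_measure \<mu> v. f i x))" for v
    by (intro Bochner_Integration.integral_sum integrable_vec_measure assms)
  then show ?thesis
    unfolding entry_integral_def
    by (subst sum_divide_distrib[symmetric], subst sum.swap) (simp only: sum_distrib_left)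
qed

lemma entry_integral_diff:
  assumes "continuous_on UNIV f" "continuous_on UNIV g"
  shows "entry_integral \<mu> j k (\<lambda>x. f x - g x) = entry_integral \<mu> j k f - entry_integral \<mu> j k g"
proof -
  have "(LINT x | vec_measure \<mu> v. f x - g x) =
      (LINT x | vec_measure \<mu> v. f x) - (LINT x | vec_measure \<mu> v. g x)" for v
    by (intro Bochner_Integration.integral_diff integrable_vec_measure assms)
  then show ?thesis
    unfolding entry_integral_def
    by (simp only: right_diff_distrib sum_subtractf diff_divide_distrib)
qed

lemma matrix_integral_mult_left:
  assumes "continuous_on UNIV F" "continuous_on UNIV G"
  shows "matrix_integral \<mu> (\<lambda>x. C ** F x) G = C ** matrix_integral \<mu> F G"
proof -
  have "entry_integral \<mu> j k (\<lambda>x. (C ** F x) $ a $ j * G x $ k $ b) =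
      (\<Sum>c\<in>UNIV. C $ a $ c * entry_integral \<mu> j k (\<lambda>x. F x $ c $ j * G x $ k $ b))" for a b j k
    unfolding entry_integral_cmult[symmetric]
    by (subst entry_integral_sum[symmetric])
       (auto simp: matrix_mult_nth sum_distrib_right mult.assoc intro!: continuous_intros assms)
  then show ?thesis
    by (simp add: vec_eq_iff matrix_integral_def matrix_mult_nth sum_distrib_left)
       (intro allI sum_rotate)
qed

lemma matrix_integral_mult_right:
  assumes "continuous_on UNIV F" "continuous_on UNIV G"
  shows "matrix_integral \<mu> F (\<lambda>x. G x ** C) = matrix_integral \<mu> F G ** C"
proof -
  have "entry_integral \<mu> j k (\<lambda>x. F x $ a $ j * (G x ** C) $ k $ b) =
      (\<Sum>c\<in>UNIV. entry_integral \<mu> j k (\<lambda>x. F x $ a $ j * G x $ k $ c) * C $ c $ b)" for a b j k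
    unfolding entry_integral_cmult_right[symmetric]
    by (subst entry_integral_sum[symmetric])
       (auto simp: matrix_mult_nth sum_distrib_left mult.assoc intro!: continuous_intros assms)
  then show ?thesis
    by (simp add: vec_eq_iff matrix_integral_def matrix_mult_nth sum_distrib_right)
       (intro allI sum_rotate)
qed

lemma matrix_integral_sum_left:
  assumes "\<And>i. i \<in> S \<Longrightarrow> continuous_on UNIV (F i)" "continuous_on UNIV G"
  shows "matrix_integral \<mu> (\<lambda>x. \<Sum>i\<in>S. F i x) G = (\<Sum>i\<in>S. matrix_integral \<mu> (F i) G)"
proof -
  have "entry_integral \<mu> j k (\<lambda>x. (\<Sum>i\<in>S. F i x) $ a $ j * G x $ k $ b) =
      (\<Sum>i\<in>S. entry_integral \<mu> j k (\<lambda>x. F i x $ a $ j * G x $ k $ b))" for a b j k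
    by (subst entry_integral_sum[symmetric])
       (auto simp: sum_distrib_right intro!: continuous_intros assms)
  then show ?thesis
    by (simp add: vec_eq_iff matrix_integral_def) (intro allI sum_rotate)
qed

lemma matrix_integral_sum_right:
  assumes "continuous_on UNIV F" "\<And>i. i \<in> S \<Longrightarrow> continuous_on UNIV (G i)"
  shows "matrix_integral \<mu> F (\<lambda>x. \<Sum>i\<in>S. G i x) = (\<Sum>i\<in>S. matrix_integral \<mu> F (G i))"
proof -
  have "entry_integral \<mu> j k (\<lambda>x. F x $ a $ j * (\<Sum>i\<in>S. G i x) $ k $ b) =
      (\<Sum>i\<in>S. entry_integral \<mu> j k (\<lambda>x. F x $ a $ j * G i x $ k $ b))" for a b j k
    by (subst entry_integral_sum[symmetric])
       (auto simp: sum_distrib_left intro!: continuous_intros assms)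
  then show ?thesis
    by (simp add: vec_eq_iff matrix_integral_def) (intro allI sum_rotate)
qed

lemma matrix_integral_diff_left:
  assumes "continuous_on UNIV F" "continuous_on UNIV F'" "continuous_on UNIV G"
  shows "matrix_integral \<mu> (\<lambda>x. F x - F' x) G = matrix_integral \<mu> F G - matrix_integral \<mu> F' G"
proof -
  have "entry_integral \<mu> j k (\<lambda>x. (F x - F' x) $ a $ j * G x $ k $ b) =
      entry_integral \<mu> j k (\<lambda>x. F x $ a $ j * G x $ k $ b) -
      entry_integral \<mu> j k (\<lambda>x. F' x $ a $ j * G x $ k $ b)" for a b j k
    by (subst entry_integral_diff[symmetric])
       (auto simp: left_diff_distrib intro!: continuous_intros assms)
  then show ?thesis
    by (simp add: matrix_integral_def vec_eq_iff sum_subtractf)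
qed

lemma matrix_integral_diff_right:
  assumes "continuous_on UNIV F" "continuous_on UNIV G" "continuous_on UNIV G'"
  shows "matrix_integral \<mu> F (\<lambda>x. G x - G' x) = matrix_integral \<mu> F G - matrix_integral \<mu> F G'"
proof -
  have "entry_integral \<mu> j k (\<lambda>x. F x $ a $ j * (G x - G' x) $ k $ b) =
      entry_integral \<mu> j k (\<lambda>x. F x $ a $ j * G x $ k $ b) -
      entry_integral \<mu> j k (\<lambda>x. F x $ a $ j * G' x $ k $ b)" for a b j k
    by (subst entry_integral_diff[symmetric])
       (auto simp: right_diff_distrib intro!: continuous_intros assms)
  then show ?thesis
    by (simp add: matrix_integral_def vec_eq_iff sum_subtractf)
qed

end


section \<open>Matrix polynomials\<close>

text \<open>
  \<open>n\<close> bounds the degree strictly and the coefficients are an arbitrary sequence. With a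
  strict bound, lower-degree polynomials and the zero polynomial need no separate treatment.
\<close>
definition matpoly :: "nat \<Rightarrow> (nat \<Rightarrow> complex^'l^'l) \<Rightarrow> complex \<Rightarrow> complex^'l^'l" where
  "matpoly n a z = (\<Sum>k<n. cscale (z ^ k) (a k))"

lemma matpoly_nth: "matpoly n a z $ i $ j = (\<Sum>k<n. a k $ i $ j * z ^ k)"
  by (simp add: matpoly_def mult.commute)

lemma continuous_on_matpoly [continuous_intros]:
  fixes a :: "nat \<Rightarrow> complex^'l^'l"
  assumes "continuous_on S f"
  shows "continuous_on S (\<lambda>x. matpoly n a (f x))"
  unfolding matpoly_def by (intro continuous_intros assms)

lemma matpoly_mult_right: "matpoly n a z ** C = matpoly n (\<lambda>k. a k ** C) z"
  unfolding vec_eq_iff matpoly_nth matrix_mult_nth sum_distrib_right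
  by (intro allI, subst sum.swap) (simp add: mult_ac)

text \<open>
  The difference quotient at \<open>w\<close> of a polynomial is a polynomial with degree bound one less. Its
  coefficients depend on \<open>w\<close>, but not on \<open>x\<close>.
\<close>

lemma matpoly_diff:
  "\<exists>b. \<forall>x. matpoly (Suc n) a x - matpoly (Suc n) a w = cscale (x - w) (matpoly n b x)"
proof -
  define b where "b = (\<lambda>k. \<chi> i j. \<Sum>r=Suc k..n. a r $ i $ j * w ^ (r - k - 1))"
  have "matpoly (Suc n) a x - matpoly (Suc n) a w = cscale (x - w) (matpoly n b x)" for x
    unfolding vec_eq_iff vector_minus_component cscale_nth matpoly_nth lessThan_Suc_atMost
    by (simp add: sub_polyfun b_def sum_distrib_right)
  then show ?thesis
    by blast
qed

lemma p_R_eq_matpoly: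
  assumes "right_orthonormal \<mu> p"
  shows "p_R p n = matpoly (Suc n) (coeff (p n))"
  using assms
  by (auto simp: right_orthonormal_def p_R_def mpoly_eval_def matpoly_def lessThan_Suc_atMost)

lemma p_L_of_real: "p_L p n (complex_of_real x) = hadjoint (p_R p n (complex_of_real x))"
  by (simp add: p_L_def)

text \<open>
  On real points the difference quotient of \<open>p\<^sub>n\<^sup>L\<close> at \<open>z\<close> is the adjoint of the one of \<open>p\<^sub>n\<^sup>R\<close> at
  \<open>cnj z\<close>.
\<close>

lemma p_L_diff:
  assumes p: "right_orthonormal \<mu> p"
  shows "\<exists>b. \<forall>x. p_L p n (complex_of_real x) - p_L p n z =
    cscale (of_real x - z) (hadjoint (matpoly n b (of_real x)))"
proof -
  obtain b where b: "\<And>x. p_R p n x - p_R p n (cnj z) = cscale (x - cnj z) (matpoly n b x)"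
    using matpoly_diff[of n "coeff (p n)" "cnj z"] by (auto simp: p_R_eq_matpoly[OF p])
  have "p_L p n (complex_of_real x) - p_L p n z = hadjoint (p_R p n (of_real x) - p_R p n (cnj z))" for x
    by (simp add: vec_eq_iff p_L_def)
  then show ?thesis
    unfolding b by (auto simp: vec_eq_iff intro!: exI[of _ b])
qed


section \<open>Orthogonality\<close>

lemma inner_R_p_R:
  assumes "right_orthonormal \<mu> p"
  shows "inner_R \<mu> (\<lambda>x. p_R p n (complex_of_real x)) (\<lambda>x. p_R p m (complex_of_real x)) =
    (if n = m then mat 1 else 0)"
  using assms by (auto simp: right_orthonormal_def p_R_def)

text \<open>
  Division from the top: an invertible leading coefficient allows the top term to be removed by
  subtracting a right multiple of \<open>p\<^sub>n\<^sup>R\<close>.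
\<close>

lemma matpoly_in_span:
  fixes p :: "nat \<Rightarrow> (complex^('l::finite)^'l) poly"
  assumes p: "right_orthonormal \<mu> p" and "\<And>k. k < n \<Longrightarrow> invertible (coeff (p k) k)"
  shows "\<exists>C. \<forall>x. matpoly n a x = (\<Sum>k<n. p_R p k x ** C k)"
  using assms(2)
proof (induction n arbitrary: a)
  case 0
  show ?case
    by (simp add: matpoly_def)
next
  case (Suc n)
  obtain A' where A': "coeff (p n) n ** A' = mat 1"
    using Suc.prems[of n] by (auto simp: invertible_def)
  define D where "D = A' ** a n"
  have D: "coeff (p n) n ** D = a n"
    by (simp add: D_def matrix_mul_assoc A')
  obtain C where C: "\<And>x. matpoly n (\<lambda>k. a k - coeff (p n) k ** D) x = (\<Sum>k<n. p_R p k x ** C k)"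
    using Suc.IH[of "\<lambda>k. a k - coeff (p n) k ** D"] Suc.prems by fastforce
  have "matpoly (Suc n) a x = (\<Sum>k<n. p_R p k x ** C k) + p_R p n x ** D" for x
  proof -
    have "matpoly (Suc n) a x = matpoly n (\<lambda>k. a k - coeff (p n) k ** D) x +
        matpoly (Suc n) (\<lambda>k. coeff (p n) k ** D) x"
      by (simp add: vec_eq_iff matpoly_nth left_diff_distrib sum_subtractf D)
    then show ?thesis
      by (simp only: C p_R_eq_matpoly[OF p] matpoly_mult_right)
  qed
  then have "matpoly (Suc n) a x = (\<Sum>k<Suc n. p_R p k x ** (C(n := D)) k)" for x
    by simp
  then show ?case
    by blast
qed

context
  fixes \<mu> :: "real set \<Rightarrow> complex^('l::finite)^'l" and p :: "nat \<Rightarrow> (complex^'l^'l) poly"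
  assumes \<mu>: "matrix_measure \<mu>" and supp: "compactly_supported \<mu>"
    and p: "right_orthonormal \<mu> p"
begin

lemma continuous_on_p_R [continuous_intros]:
  assumes "continuous_on S f"
  shows "continuous_on S (\<lambda>x. p_R p n (f x))"
  unfolding p_R_eq_matpoly[OF p] by (intro continuous_intros assms)

lemma continuous_on_p_L [continuous_intros]:
  "continuous_on UNIV (\<lambda>x. p_L p n (complex_of_real x))"
  unfolding p_L_of_real by (intro continuous_intros)

text \<open>
  The invertibility hypothesis is restricted to indices below \<open>j\<close> because the induction that
  proves invertibility uses this lemma.
\<close>

lemma orthogonal_if_invertible:
  assumes "\<And>k. k < j \<Longrightarrow> invertible (coeff (p k) k)" "j \<le> n"
  shows "inner_R \<mu> (\<lambda>x. p_R p n (complex_of_real x)) (\<lambda>x. matpoly j a (complex_of_real x)) = 0"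
    and "inner_R \<mu> (\<lambda>x. matpoly j a (complex_of_real x)) (\<lambda>x. p_R p n (complex_of_real x)) = 0"
proof -
  obtain C where C: "\<And>x. matpoly j a x = (\<Sum>k<j. p_R p k x ** C k)"
    using matpoly_in_span[OF p assms(1)] by blast
  have "inner_R \<mu> (\<lambda>x. p_R p n (complex_of_real x)) (\<lambda>x. matpoly j a (complex_of_real x)) =
      (\<Sum>k<j. inner_R \<mu> (\<lambda>x. p_R p n (complex_of_real x)) (\<lambda>x. p_R p k (complex_of_real x)) ** C k)"
    unfolding inner_R_def C
    by (simp add: matrix_integral_sum_right[OF \<mu> supp] matrix_integral_mult_right[OF \<mu> supp]
        continuous_intros)
  also have "\<dots> = 0"
    using assms(2) by (intro sum.neutral) (auto simp: inner_R_p_R[OF p])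
  finally show "inner_R \<mu> (\<lambda>x. p_R p n (complex_of_real x)) (\<lambda>x. matpoly j a (complex_of_real x)) = 0" .
  have "inner_R \<mu> (\<lambda>x. matpoly j a (complex_of_real x)) (\<lambda>x. p_R p n (complex_of_real x)) =
      (\<Sum>k<j. hadjoint (C k) **
        inner_R \<mu> (\<lambda>x. p_R p k (complex_of_real x)) (\<lambda>x. p_R p n (complex_of_real x)))"
    unfolding inner_R_def C hadjoint_sum hadjoint_matrix_mult
    by (simp add: matrix_integral_sum_left[OF \<mu> supp] matrix_integral_mult_left[OF \<mu> supp]
        continuous_intros)
  also have "\<dots> = 0"
    using assms(2) by (intro sum.neutral) (auto simp: inner_R_p_R[OF p])
  finally show "inner_R \<mu> (\<lambda>x. matpoly j a (complex_of_real x)) (\<lambda>x. p_R p n (complex_of_real x)) = 0" .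
qed

text \<open>
  If the leading coefficient annihilated a non-zero \<open>V\<close>, then \<open>p\<^sub>n\<^sup>R V\<close> would have lower degree,
  hence be orthogonal to \<open>p\<^sub>n\<^sup>R\<close>; but its inner product with \<open>p\<^sub>n\<^sup>R\<close> is \<open>V\<close>.
\<close>

lemma invertible_lead_coeff: "invertible (coeff (p n) n)"
proof (induction n rule: less_induct)
  case (less n)
  show ?case
  proof (rule invertible_if_right_cancel_zero)
    fix V :: "complex^'l^'l"
    assume V: "coeff (p n) n ** V = 0"
    have pV: "p_R p n x ** V = matpoly n (\<lambda>k. coeff (p n) k ** V) x" for x
      unfolding p_R_eq_matpoly[OF p] matpoly_mult_right by (simp add: vec_eq_iff matpoly_nth V)
    have "V = inner_R \<mu> (\<lambda>x. p_R p n (complex_of_real x)) (\<lambda>x. p_R p n (complex_of_real x)) ** V"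
      by (simp add: inner_R_p_R[OF p])
    also have "\<dots> = inner_R \<mu> (\<lambda>x. p_R p n (complex_of_real x)) (\<lambda>x. p_R p n (complex_of_real x) ** V)"
      unfolding inner_R_def
      by (rule matrix_integral_mult_right[OF \<mu> supp, symmetric]) (intro continuous_intros)+
    also have "\<dots> = 0"
      unfolding pV by (rule orthogonal_if_invertible(1)) (use less in auto)
    finally show "V = 0" .
  qed
qed

lemmas orthogonal_to_lower_degree = orthogonal_if_invertible[OF invertible_lead_coeff]


section \<open>The Green function\<close>

context
  fixes z :: complex
  assumes z: "Im z \<noteq> 0"
begin

lemma nonreal: "complex_of_real x \<noteq> z" "complex_of_real x \<noteq> cnj z"
  using z by (auto simp: complex_eq_iff)

lemma continuous_on_resolvent [continuous_intros]:
  "continuous_on UNIV (\<lambda>x. 1 / (complex_of_real x - z))"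
  by (intro continuous_intros) (simp add: nonreal)

text \<open>
  The integrand of \<open>q\<^sub>n\<^sup>R\<close> is \<open>p\<^sub>n\<^sup>R(x) / (x - z) - p\<^sub>n\<^sup>R(z) / (x - z)\<close>, and the second part
  integrates to \<open>m(z) p\<^sub>n\<^sup>R(z)\<close>.
\<close>

lemma psi_R_eq_integral:
  "psi_R \<mu> p n z = matrix_integral \<mu> (\<lambda>x. mat 1)
     (\<lambda>x. cscale (1 / (of_real x - z)) (p_R p n (of_real x)))"
proof -
  have m: "m_fun \<mu> z ** p_R p n z =
      matrix_integral \<mu> (\<lambda>x. mat 1) (\<lambda>x. cscale (1 / (of_real x - z)) (mat 1) ** p_R p n z)"
    unfolding m_fun_def
    by (rule matrix_integral_mult_right[OF \<mu> supp, symmetric]) (intro continuous_intros)+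
  have "q_R \<mu> p n z = matrix_integral \<mu> (\<lambda>x. mat 1)
      (\<lambda>x. cscale (1 / (of_real x - z)) (p_R p n (of_real x)) -
        cscale (1 / (of_real x - z)) (mat 1) ** p_R p n z)"
    unfolding q_R_def cscale_matrix_mult_left matrix_mul_lid
    by (rule arg_cong[of _ _ "matrix_integral \<mu> _"])
       (simp add: fun_eq_iff vec_eq_iff divide_simps nonreal nonreal[symmetric] algebra_simps)
  also have "\<dots> = matrix_integral \<mu> (\<lambda>x. mat 1) (\<lambda>x. cscale (1 / (of_real x - z)) (p_R p n (of_real x))) -
      matrix_integral \<mu> (\<lambda>x. mat 1) (\<lambda>x. cscale (1 / (of_real x - z)) (mat 1) ** p_R p n z)"
    by (rule matrix_integral_diff_right[OF \<mu> supp]) (intro continuous_intros)+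
  finally show ?thesis
    using m by (simp add: psi_R_def)
qed

lemma psi_L_eq_integral:
  "psi_L \<mu> p n z = matrix_integral \<mu>
     (\<lambda>x. cscale (1 / (of_real x - z)) (p_L p n (of_real x))) (\<lambda>x. mat 1)"
proof -
  have "p_L p n z ** m_fun \<mu> z =
      matrix_integral \<mu> (\<lambda>x. p_L p n z ** mat 1) (\<lambda>x. cscale (1 / (of_real x - z)) (mat 1))"
    unfolding m_fun_def
    by (rule matrix_integral_mult_left[OF \<mu> supp, symmetric]) (intro continuous_intros)+
  also have "\<dots> = matrix_integral \<mu> (\<lambda>x. cscale (1 / (of_real x - z)) (p_L p n z)) (\<lambda>x. mat 1)"
    by (simp add: matrix_integral_cscale)
  finally have m: "p_L p n z ** m_fun \<mu> z =
      matrix_integral \<mu> (\<lambda>x. cscale (1 / (of_real x - z)) (p_L p n z)) (\<lambda>x. mat 1)" .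
  have "q_L \<mu> p n z = matrix_integral \<mu>
      (\<lambda>x. cscale (1 / (of_real x - z)) (p_L p n (of_real x)) -
        cscale (1 / (of_real x - z)) (p_L p n z)) (\<lambda>x. mat 1)"
    unfolding q_L_def
    by (rule arg_cong[of _ _ "\<lambda>F. matrix_integral \<mu> F _"])
       (simp add: fun_eq_iff vec_eq_iff divide_simps nonreal nonreal[symmetric] algebra_simps)
  also have "\<dots> = matrix_integral \<mu> (\<lambda>x. cscale (1 / (of_real x - z)) (p_L p n (of_real x))) (\<lambda>x. mat 1) -
      matrix_integral \<mu> (\<lambda>x. cscale (1 / (of_real x - z)) (p_L p n z)) (\<lambda>x. mat 1)"
    by (rule matrix_integral_diff_left[OF \<mu> supp]) (intro continuous_intros)+
  finally show ?thesis
    using m by (simp add: psi_L_def)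
qed

text \<open>
  In both factorizations the error term is an inner product of an orthonormal polynomial with a
  difference quotient of degree strictly below it, which vanishes. Here the quotient is that of
  \<open>p\<^sub>n\<^sup>L\<close>.
\<close>

lemma green_eq_p_L_psi_R:
  assumes "n \<le> m"
  shows "green \<mu> p (Suc n) (Suc m) z = p_L p n z ** psi_R \<mu> p m z"
proof -
  define r where "r = (\<lambda>x. 1 / (complex_of_real x - z))"
  have r: "continuous_on UNIV r"
    unfolding r_def by (rule continuous_on_resolvent)
  have r_fold: "1 / (complex_of_real x - z) = r x" for x
    by (simp add: r_def)
  obtain b where b: "\<And>x. p_L p n (complex_of_real x) - p_L p n z =
      cscale (of_real x - z) (hadjoint (matpoly n b (of_real x)))"
    using p_L_diff[OF p] by blast
  have "p_L p n z ** psi_R \<mu> p m z =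
      matrix_integral \<mu> (\<lambda>x. p_L p n z ** mat 1) (\<lambda>x. cscale (r x) (p_R p m (of_real x)))"
    unfolding psi_R_eq_integral r_fold
    by (rule matrix_integral_mult_left[OF \<mu> supp, symmetric]) (intro continuous_intros r)+
  then have "green \<mu> p (Suc n) (Suc m) z - p_L p n z ** psi_R \<mu> p m z =
      matrix_integral \<mu> (\<lambda>x. p_L p n (of_real x) - p_L p n z)
        (\<lambda>x. cscale (r x) (p_R p m (of_real x)))"
    by (subst matrix_integral_diff_left[OF \<mu> supp])
       (auto simp: green_def inner_R_def p_L_of_real r_fold intro!: continuous_intros r)
  also have "\<dots> = matrix_integral \<mu> (\<lambda>x. cscale (r x) (p_L p n (of_real x) - p_L p n z))
      (\<lambda>x. p_R p m (of_real x))"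
    by (rule matrix_integral_cscale)
  also have "\<dots> = inner_R \<mu> (\<lambda>x. matpoly n b (of_real x)) (\<lambda>x. p_R p m (of_real x))"
    unfolding inner_R_def b
    by (rule arg_cong[of _ _ "\<lambda>F. matrix_integral \<mu> F _"])
       (simp add: fun_eq_iff vec_eq_iff r_def nonreal)
  also have "\<dots> = 0"
    by (rule orthogonal_to_lower_degree(2)[OF assms])
  finally show ?thesis
    by simp
qed

text \<open>
  Here the difference quotient is that of \<open>p\<^sub>m\<^sup>R\<close>, which has degree below \<open>m \<le> n\<close>.
\<close>

lemma green_eq_psi_L_p_R:
  assumes "m \<le> n"
  shows "green \<mu> p (Suc n) (Suc m) z = psi_L \<mu> p n z ** p_R p m z"
proof -
  define r where "r = (\<lambda>x. 1 / (complex_of_real x - z))"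
  have r: "continuous_on UNIV r"
    unfolding r_def by (rule continuous_on_resolvent)
  have r_fold: "1 / (complex_of_real x - z) = r x" for x
    by (simp add: r_def)
  obtain b where b: "\<And>x. p_R p m x - p_R p m z = cscale (x - z) (matpoly m b x)"
    using matpoly_diff[of m "coeff (p m)" z] by (auto simp: p_R_eq_matpoly[OF p])
  have "psi_L \<mu> p n z ** p_R p m z =
      matrix_integral \<mu> (\<lambda>x. cscale (r x) (p_L p n (of_real x))) (\<lambda>x. mat 1 ** p_R p m z)"
    unfolding psi_L_eq_integral r_fold p_L_of_real
    by (rule matrix_integral_mult_right[OF \<mu> supp, symmetric]) (intro continuous_intros r)+
  also have "\<dots> = matrix_integral \<mu> (\<lambda>x. p_L p n (of_real x)) (\<lambda>x. cscale (r x) (p_R p m z))"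
    by (simp add: matrix_integral_cscale)
  finally have "green \<mu> p (Suc n) (Suc m) z - psi_L \<mu> p n z ** p_R p m z =
      matrix_integral \<mu> (\<lambda>x. p_L p n (of_real x))
        (\<lambda>x. cscale (r x) (p_R p m (of_real x)) - cscale (r x) (p_R p m z))"
    by (subst matrix_integral_diff_right[OF \<mu> supp])
       (auto simp: green_def inner_R_def p_L_of_real r_fold intro!: continuous_intros r)
  also have "\<dots> = inner_R \<mu> (\<lambda>x. p_R p n (of_real x)) (\<lambda>x. matpoly m b (of_real x))"
    unfolding inner_R_def p_L_of_real cscale_diff[symmetric] b
    by (rule arg_cong[of _ _ "matrix_integral \<mu> _"])
       (simp add: fun_eq_iff vec_eq_iff r_def nonreal)
  also have "\<dots> = 0"
    by (rule orthogonal_to_lower_degree(1)[OF assms])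
  finally show ?thesis
    by simp
qed

end

end

theorem theorem2p29:
  fixes \<mu> :: "real set \<Rightarrow> complex^('l::finite)^'l"
    and p :: "nat \<Rightarrow> (complex^'l^'l) poly"
    and z :: complex and n m :: nat
  assumes "matrix_measure \<mu>" and "compactly_supported \<mu>" and "\<mu> UNIV = mat 1"
    and "nontrivial \<mu>"
    and "right_orthonormal \<mu> p"
    and "Im z > 0" and "n \<ge> 1" and "m \<ge> 1"
  shows "(n \<ge> m \<longrightarrow> green \<mu> p n m z = psi_L \<mu> p (n - 1) z ** p_R p (m - 1) z) \<and>
         (n \<le> m \<longrightarrow> green \<mu> p n m z = p_L p (n - 1) z ** psi_R \<mu> p (m - 1) z)"
proof -
  obtain n' m' where nm: "n = Suc n'" "m = Suc m'"
    using assms(7,8) by (metis Suc_le_D One_nat_def)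
  have z: "Im z \<noteq> 0"
    using assms(6) by simp
  show ?thesis
    using green_eq_psi_L_p_R[OF assms(1,2,5) z] green_eq_p_L_psi_R[OF assms(1,2,5) z]
    by (simp add: nm)
qed

end
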